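(* Let $q=2^h$ with $h\ge5$ odd, and let $$\mathcal{H}=\{(1,t,t^{1/6}+t^{3/6}+t^{5/6}) : t\in\mathbb{F}_q\}\cup\{(0,0,1),(0,1,0)\}$$ be the Payne hyperoval of $\mathbf{PG}(2,q)$, embedded as the hyperplane $U=0$ of $\mathbf{PG}(3,q)$ with coordinates $(X,Y,Z,U)$. Let $$g=\begin{pmatrix}0&1&0&1\\1&0&0&0\\0&0&1&0\\0&0&0&1\end{pmatrix},\qquad h_{(a,b,c)}=\begin{pmatrix}1&0&0&a\\0&1&0&b\\0&0&1&c\\0&0&0&1\end{pmatrix}.$$ There exist additive subgroups $D$ of $(\mathbb{F}_q,+)^3$ of order $2^{3h-1}$ such that $(1,0,0)\notin D$, $(1,1,0)\in D$, and $(a,b,c)\in D$ implies $(b,a,c)\in D$. For each such $D$, putting $T=\{h_{(a,b,c)} : (a,b,c)\in D\}$, the group $S=\langle g,T\rangle$ acts as a Singer group on $\mathbf{T}_2^*(\mathcal{H})$; it has exponent $4$ and its intersection with the translation group $\{h_{(a,b,c)} : a,b,c\in\mathbb{F}_q\}$ has order $q^3/2$.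
   Context: Exponents $1/6,3/6,5/6$ are taken modulo $q-1$ (6 is invertible modulo $q-1$ since $h$ is odd). For a hyperoval $\mathcal{H}$ (a set of $q+2$ points, no three collinear) in $\mathbf{PG}(2,q)\subset\mathbf{PG}(3,q)$, $\mathbf{T}_2^*(\mathcal{H})$ is the generalized quadrangle of order $(q-1,q+1)$ whose points are the points of $\mathbf{PG}(3,q)\setminus\mathbf{PG}(2,q)$ and whose lines are the lines of $\mathbf{PG}(3,q)$ meeting $\mathbf{PG}(2,q)$ exactly in a point of $\mathcal{H}$, with natural incidence. A Singer group is a group of automorphisms acting sharply transitively on the points. Matrices act on column vectors $(X,Y,Z,U)^T$. *)

theory Defs
  imports
    "HOL-Analysis.Analysis"
    "HOL-Number_Theory.Modular_Inverse"
    "HOL-Algebra.Generated_Groups"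
    "HOL-Algebra.Group_Action"
begin

subsection \<open>Projective space\<close>

text \<open>
  Points and lines of \<open>PG(3,q)\<close> are the linear subspaces of \<open>F\<^sup>4\<close> of vector space dimension 1
  and 2; incidence is inclusion. The coordinates \<open>X, Y, Z, U\<close> are the components 1, 2, 3, 4
  (in the index type \<open>4\<close>, the numeral 4 is the element 0).
\<close>

definition pg_points :: "('a::field ^ 4) set set" where
  "pg_points = {P. vec.subspace P \<and> vec.dim P = 1}"

definition pg_lines :: "('a::field ^ 4) set set" where
  "pg_lines = {L. vec.subspace L \<and> vec.dim L = 2}"

definition plane_at_infinity :: "('a::field ^ 4) set" where
  "plane_at_infinity = {v. v $ 4 = 0}"

definition pg_point :: "'a::field \<Rightarrow> 'a \<Rightarrow> 'a \<Rightarrow> 'a \<Rightarrow> ('a ^ 4) set" where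
  "pg_point x y z u = vec.span {vector [x, y, z, u]}"


subsection \<open>Incidence structures and Singer groups\<close>

record ('p, 'l) incidence_structure =
  Points :: "'p set"
  Lines :: "'l set"
  Incident :: "'p \<Rightarrow> 'l \<Rightarrow> bool"

definition is_automorphism ::
    "('p, 'l) incidence_structure \<Rightarrow> ('p \<Rightarrow> 'p) \<Rightarrow> ('l \<Rightarrow> 'l) \<Rightarrow> bool" where
  "is_automorphism \<Gamma> \<alpha> \<beta> \<longleftrightarrow>
     bij_betw \<alpha> (Points \<Gamma>) (Points \<Gamma>) \<and> bij_betw \<beta> (Lines \<Gamma>) (Lines \<Gamma>) \<and>
     (\<forall>p\<in>Points \<Gamma>. \<forall>l\<in>Lines \<Gamma>. Incident \<Gamma> (\<alpha> p) (\<beta> l) \<longleftrightarrow> Incident \<Gamma> p l)"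

text \<open>
  The group \<open>G\<close> acts on \<open>\<Gamma>\<close> by automorphisms, through \<open>\<phi>\<close> on points and \<open>\<psi>\<close> on lines, and
  sharply transitively on points. The last condition makes the action faithful as soon as
  there is a point, so \<open>G\<close> is identified with a group of automorphisms.
\<close>

definition acts_as_Singer_group ::
    "('g, 'm) monoid_scheme \<Rightarrow> ('p, 'l) incidence_structure \<Rightarrow>
      ('g \<Rightarrow> 'p \<Rightarrow> 'p) \<Rightarrow> ('g \<Rightarrow> 'l \<Rightarrow> 'l) \<Rightarrow> bool" where
  "acts_as_Singer_group G \<Gamma> \<phi> \<psi> \<longleftrightarrow>
     group_action G (Points \<Gamma>) \<phi> \<and> group_action G (Lines \<Gamma>) \<psi> \<and>
     (\<forall>x\<in>carrier G. is_automorphism \<Gamma> (\<phi> x) (\<psi> x)) \<and>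
     (\<forall>p\<in>Points \<Gamma>. \<forall>p'\<in>Points \<Gamma>. \<exists>!x. x \<in> carrier G \<and> \<phi> x p = p')"

definition has_exponent :: "('g, 'm) monoid_scheme \<Rightarrow> nat \<Rightarrow> bool" where
  "has_exponent G n \<longleftrightarrow>
     n > 0 \<and> (\<forall>x\<in>carrier G. x [^]\<^bsub>G\<^esub> n = \<one>\<^bsub>G\<^esub>) \<and>
     (\<forall>m. 0 < m \<and> m < n \<longrightarrow> \<not> (\<forall>x\<in>carrier G. x [^]\<^bsub>G\<^esub> m = \<one>\<^bsub>G\<^esub>))"


subsection \<open>The geometry \<open>T\<^sub>2\<^sup>*(\<H>)\<close> and the Payne hyperoval\<close>

definition T2star :: "('a::field ^ 4) set set \<Rightarrow>
    (('a ^ 4) set, ('a ^ 4) set) incidence_structure" where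
  "T2star \<H> =
     \<lparr> Points = {P \<in> pg_points. \<not> P \<subseteq> plane_at_infinity},
       Lines = {L \<in> pg_lines. \<exists>P\<in>\<H>. {Q \<in> pg_points. Q \<subseteq> L \<and> Q \<subseteq> plane_at_infinity} = {P}},
       Incident = (\<lambda>P L. P \<subseteq> L) \<rparr>"

text \<open>
  The representative in \<open>{0..<q-1}\<close> of \<open>k/6\<close> modulo \<open>q-1\<close>. For \<open>q = 2^h\<close> with \<open>h \<ge> 5\<close> odd it
  is positive for \<open>k = 1, 3, 5\<close>, so that \<open>0\<close> raised to it is \<open>0\<close>.
\<close>

definition sixths :: "nat \<Rightarrow> nat \<Rightarrow> nat" where
  "sixths q k = nat ((int k * modular_inverse (int q - 1) 6) mod (int q - 1))"

definition payne_fun :: "'a::{field,finite} \<Rightarrow> 'a" where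
  "payne_fun t = t ^ sixths CARD('a) 1 + t ^ sixths CARD('a) 3 + t ^ sixths CARD('a) 5"

definition payne_hyperoval :: "('a::{field,finite} ^ 4) set set" where
  "payne_hyperoval =
     {pg_point 1 t (payne_fun t) 0 | t. True} \<union> {pg_point 0 0 1 0, pg_point 0 1 0 0}"


subsection \<open>The matrix groups\<close>

definition GL4 :: "('a::field ^ 4 ^ 4) monoid" where
  "GL4 = \<lparr> carrier = {A. invertible A}, monoid.mult = (**), one = mat 1 \<rparr>"

definition mat_g :: "'a::field ^ 4 ^ 4" where
  "mat_g = vector
     [vector [0, 1, 0, 1],
      vector [1, 0, 0, 0],
      vector [0, 0, 1, 0],
      vector [0, 0, 0, 1]]"

definition mat_h :: "'a \<times> 'a \<times> 'a \<Rightarrow> 'a::field ^ 4 ^ 4" where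
  "mat_h = (\<lambda>(a, b, c). vector
     [vector [1, 0, 0, a],
      vector [0, 1, 0, b],
      vector [0, 0, 1, c],
      vector [0, 0, 0, 1]])"

definition group_S :: "('a \<times> 'a \<times> 'a) set \<Rightarrow> ('a::field ^ 4 ^ 4) monoid" where
  "group_S D = GL4 \<lparr> carrier := generate GL4 ({mat_g} \<union> mat_h ` D) \<rparr>"

text \<open>
  The library's \<^const>\<open>group_action\<close> asks for permutations that are undefined off the set
  acted on, hence the restriction to \<open>E\<close>.
\<close>

definition mat_action :: "('a::field ^ 4) set set \<Rightarrow> 'a ^ 4 ^ 4 \<Rightarrow> ('a ^ 4) set \<Rightarrow> ('a ^ 4) set" where
  "mat_action E A = (\<lambda>W\<in>E. (*v) A ` W)"

definition additive_group :: "'b::ab_group_add monoid" where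
  "additive_group = \<lparr> carrier = UNIV, monoid.mult = (+), one = 0 \<rparr>"

definition admissible :: "nat \<Rightarrow> ('a::field \<times> 'a \<times> 'a) set \<Rightarrow> bool" where
  "admissible h D \<longleftrightarrow>
     subgroup D additive_group \<and> card D = 2 ^ (3 * h - 1) \<and>
     (1, 0, 0) \<notin> D \<and> (1, 1, 0) \<in> D \<and>
     (\<forall>a b c. (a, b, c) \<in> D \<longrightarrow> (b, a, c) \<in> D)"

end

(*
  On the affine points (x, y, z, 1), g acts as (x, y, z) |-> (y + 1, x, z), so g^2 is the
  translation by (1, 1, 0) and g normalises T; hence S is the union of T and Tg. As D has index 2
  and is invariant under the swap, it contains every (s, s, 0), so it contains no (s + 1, s, 0).
  Therefore exactly one of w - v and w - g v lies in D, which is sharp transitivity. On the plane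
  at infinity T is trivial and g swaps X and Y; the Payne hyperoval is invariant under this
  because f(t) = t f(1/t).
*)

theory Submission
  imports Defs "HOL-Number_Theory.Residues"
begin

section \<open>Finite fields of characteristic two\<close>

text \<open>Multiplication by \<open>x\<close> permutes the nonzero elements, so it preserves their
  product while contributing the factor \<open>x ^ (q - 1)\<close>; that product is nonzero and
  cancels.\<close>

lemma finite_field_power_card_minus_1:
  fixes x :: "'a::{field,finite}"
  assumes "x \<noteq> 0"
  shows "x ^ (CARD('a) - 1) = 1"
proof -
  have "(\<Prod>y\<in>UNIV-{0}. x * y) = x ^ (CARD('a) - 1) * \<Prod>(UNIV-{0})"
    by (simp add: prod.distrib)
  moreover have "(\<Prod>y\<in>UNIV-{0}. x * y) = (\<Prod>y\<in>UNIV-{0}. y)"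
    by (rule prod.reindex_bij_witness[of _ "\<lambda>y. y / x" "\<lambda>y. x * y"]) (use assms in auto)
  moreover have "\<Prod>(UNIV-{0::'a}) \<noteq> 0"
    by simp
  ultimately show ?thesis
    by simp
qed

lemma two_eq_0_if_card:
  assumes "CARD('a::{field,finite}) = 2 ^ h"
  shows "(2::'a) = 0"
proof -
  have "of_nat (2 ^ h) = (0::'a)"
    using CHAR_dvd_CARD[where 'a='a] assms by (metis of_nat_eq_0_iff_char_dvd)
  then show ?thesis
    by simp
qed

lemma char_2_add_self:
  assumes "(2::'a::field) = 0"
  shows "x + x = (0::'a)"
  using assms by (metis mult_2 mult_zero_left)

text \<open>Take a subgroup maximal among those avoiding \<open>v\<close>; maximality forces its
  complement to be the single coset \<open>v + A\<close>. As every element is its own inverse,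
  closure under addition already makes a subgroup.\<close>

lemma exists_index_2_subgroup_avoiding:
  fixes v :: "'b::{ab_group_add,finite}"
  assumes exp: "\<And>x::'b. x + x = 0" and "v \<noteq> 0"
  obtains A :: "'b set" where "0 \<in> A" "\<And>x y. x \<in> A \<Longrightarrow> y \<in> A \<Longrightarrow> x + y \<in> A" "v \<notin> A"
    "2 * card A = CARD('b)"
proof -
  define F where "F = {A :: 'b set. 0 \<in> A \<and> (\<forall>x\<in>A. \<forall>y\<in>A. x + y \<in> A) \<and> v \<notin> A}"
  have "{0} \<in> F"
    using \<open>v \<noteq> 0\<close> by (simp add: F_def)
  then obtain A where A: "A \<in> F" and max: "\<And>B. B \<in> F \<Longrightarrow> A \<subseteq> B \<Longrightarrow> B = A"
    using finite_has_maximal[of F] by (metis empty_iff finite)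
  from A have zero: "0 \<in> A" and add: "\<And>x y. x \<in> A \<Longrightarrow> y \<in> A \<Longrightarrow> x + y \<in> A" and v: "v \<notin> A"
    by (auto simp: F_def)
  have cancel: "x + (x + y) = y" for x y :: 'b
    by (metis exp add.assoc add_0)
  \<comment> \<open>Otherwise adjoining \<open>x\<close> gives the strictly larger subgroup
    \<open>A\<close> together with \<open>x + A\<close>, which still avoids \<open>v\<close>: from
    \<open>v = x + a\<close> one would get \<open>x = v + a\<close>.\<close>
  have cover: "x \<in> A \<union> (+) v ` A" for x
  proof (rule ccontr)
    assume x: "x \<notin> A \<union> (+) v ` A"
    define B where "B = A \<union> (+) x ` A"
    have "v \<notin> B"
    proof
      assume "v \<in> B"
      then obtain a where "a \<in> A" "v = x + a"
        using v by (auto simp: B_def)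
      then have "x = v + a"
        using exp[of a] by (simp add: add.assoc)
      then show False
        using x \<open>a \<in> A\<close> by blast
    qed
    moreover have "y + z \<in> B" if "y \<in> B" "z \<in> B" for y z
    proof -
      from that obtain a b where "a \<in> A" "b \<in> A" "y = a \<or> y = x + a" "z = b \<or> z = x + b"
        by (auto simp: B_def)
      moreover have "x + a + (x + b) = a + b" "a + (x + b) = x + (a + b)"
        using cancel[of x] by (simp_all add: ac_simps)
      ultimately have "y + z = a + b \<or> y + z = x + (a + b)"
        by (metis add.assoc)
      then show ?thesis
        using add[OF \<open>a \<in> A\<close> \<open>b \<in> A\<close>] by (auto simp: B_def)
    qed
    ultimately have "B \<in> F"
      using zero by (auto simp: F_def B_def)
    then have "B = A"
      by (rule max) (simp add: B_def)
    then show False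
      using x zero by (force simp: B_def)
  qed
  have disj: "A \<inter> (+) v ` A = {}"
  proof (rule ccontr)
    assume "A \<inter> (+) v ` A \<noteq> {}"
    then obtain a where a: "a \<in> A" "v + a \<in> A"
      by blast
    have "v = v + a + a"
      using exp[of a] by (simp add: add.assoc)
    then show False
      using add[OF a(2,1)] v by metis
  qed
  have "CARD('b) = card (A \<union> (+) v ` A)"
    using cover by (metis UNIV_eq_I)
  also have "\<dots> = 2 * card A"
    using disj by (simp add: card_Un_disjoint card_image)
  finally show ?thesis
    using that zero add v by simp
qed


section \<open>Existence of admissible subgroups\<close>

lemma subgroup_additive_groupI:
  fixes D :: "'b::ab_group_add set"
  assumes exp: "\<And>x::'b. x + x = 0" and "0 \<in> D" "\<And>x y. x \<in> D \<Longrightarrow> y \<in> D \<Longrightarrow> x + y \<in> D"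
  shows "subgroup D additive_group"
proof -
  have G: "group (additive_group :: 'b monoid)"
    by (rule groupI)
      (auto simp: additive_group_def add.assoc intro: left_minus)
  have "inv\<^bsub>additive_group\<^esub> x = x" for x :: 'b
    using exp[of x] by (intro group.inv_equality[OF G]) (auto simp: additive_group_def)
  with assms show ?thesis
    by (intro group.subgroupI[OF G]) (auto simp: additive_group_def)
qed

text \<open>Choose an index 2 subgroup \<open>A\<close> of the additive group of the field missing
  1, and require \<open>a + b\<close> to lie in it. This sum is symmetric in \<open>a\<close> and
  \<open>b\<close>, equals 1 at (1, 0, 0) and 0 at (1, 1, 0).\<close>

lemma admissible_exists:
  assumes card: "CARD('a::{field,finite}) = 2 ^ h" and "h > 0"
  shows "\<exists>D :: ('a \<times> 'a \<times> 'a) set. admissible h D"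
proof -
  have two: "(2::'a) = 0"
    using card by (rule two_eq_0_if_card)
  note self = char_2_add_self[OF two]
  obtain A :: "'a set" where A: "0 \<in> A" "\<And>x y. x \<in> A \<Longrightarrow> y \<in> A \<Longrightarrow> x + y \<in> A" "1 \<notin> A"
    "2 * card A = CARD('a)"
    using exists_index_2_subgroup_avoiding[OF self one_neq_zero] by blast
  define D where "D = {(a, b, c :: 'a). a + b \<in> A}"
  have cancel: "x + y + y = x" for x y :: 'a
    using self[of y] by (simp add: add.assoc)
  \<comment> \<open>The new parameter is \<open>s = a + b\<close>; with \<open>b\<close> and
    \<open>c\<close> free it determines \<open>a\<close>, so \<open>D\<close> has
    \<open>card A\<close> times q^2 elements.\<close>
  have "bij_betw (\<lambda>(s, b, c). (s + b, b, c)) (A \<times> UNIV \<times> UNIV) D"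
    by (rule bij_betw_byWitness[where f' = "\<lambda>(a, b, c). (a + b, b, c)"])
      (auto simp: D_def cancel)
  then have "card D = card A * (CARD('a) * CARD('a))"
    by (simp add: bij_betw_same_card[symmetric] card_cartesian_product)
  then have "2 * card D = 2 ^ (3 * h)"
    using A(4) card by (simp add: power_add power_mult_distrib eval_nat_numeral flip: mult.assoc)
  also have "\<dots> = 2 * 2 ^ (3 * h - 1)"
    using \<open>h > 0\<close> by (simp flip: power_Suc)
  finally have "card D = 2 ^ (3 * h - 1)"
    by simp
  moreover have "subgroup D additive_group"
  proof (rule subgroup_additive_groupI)
    show "x + y \<in> D" if "x \<in> D" "y \<in> D" for x y
    proof -
      obtain a b c a' b' c' where "x = (a, b, c)" "y = (a', b', c')"
        by (metis surj_pair)
      with that A(2)[of "a + b" "a' + b'"] show ?thesis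
        by (simp add: D_def ac_simps)
    qed
  qed (use self A(1) in \<open>auto simp: D_def zero_prod_def\<close>)
  ultimately show ?thesis
    using A(1,3) self[of 1] by (auto simp: admissible_def D_def add.commute)
qed


section \<open>The matrices\<close>

lemma vector_4 [simp]:
  "(vector [x, y, z, u] :: 'a::zero ^ 4) $ 1 = x"
  "(vector [x, y, z, u] :: 'a::zero ^ 4) $ 2 = y"
  "(vector [x, y, z, u] :: 'a::zero ^ 4) $ 3 = z"
  "(vector [x, y, z, u] :: 'a::zero ^ 4) $ 4 = u"
  unfolding vector_def by simp_all

lemma vector_4_eq_iff [simp]:
  "(vector [x, y, z, u] :: 'a::zero ^ 4) = vector [x', y', z', u'] \<longleftrightarrow>
     x = x' \<and> y = y' \<and> z = z' \<and> u = u'"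
  by (auto simp: vec_eq_iff forall_4)

lemma vector_4_cases:
  obtains x y z u where "(v :: 'a::zero ^ 4) = vector [x, y, z, u]"
  using that[of "v $ 1" "v $ 2" "v $ 3" "v $ 4"] by (simp add: vec_eq_iff forall_4)

lemma scale_vector_4 [simp]:
  "c *s (vector [x, y, z, u] :: 'a::field ^ 4) = vector [c * x, c * y, c * z, c * u]"
  by (simp add: vec_eq_iff forall_4)

text \<open>Reduces matrix identities to coordinate computations with the images of a general column
  vector.\<close>

lemma matrix_eq_iff_vector_4:
  fixes A B :: "'a::field ^ 4 ^ 4"
  shows "A = B \<longleftrightarrow> (\<forall>x y z u. A *v vector [x, y, z, u] = B *v vector [x, y, z, u])"
  by (metis matrix_eq vector_4_cases)

lemma mat_g_mult_vector [simp]: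
  "mat_g *v vector [x, y, z, u] = (vector [y + u, x, z, u] :: 'a::field ^ 4)"
  by (simp add: mat_g_def vec_eq_iff forall_4 matrix_vector_mult_def sum_4)

lemma mat_h_mult_vector [simp]:
  "mat_h (a, b, c) *v vector [x, y, z, u] =
     (vector [x + a * u, y + b * u, z + c * u, u] :: 'a::field ^ 4)"
  by (simp add: mat_h_def vec_eq_iff forall_4 matrix_vector_mult_def sum_4)

lemma mat_h_mult: "mat_h d ** mat_h e = (mat_h (d + e) :: 'a::field ^ 4 ^ 4)"
  by (cases d; cases e)
    (simp add: matrix_eq_iff_vector_4 algebra_simps flip: matrix_vector_mul_assoc)

lemma mat_h_0: "mat_h 0 = (mat 1 :: 'a::field ^ 4 ^ 4)"
  by (simp add: matrix_eq_iff_vector_4 zero_prod_def)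

text \<open>Conjugation by g swaps the first two entries of a translation vector; this is why
  invariance of \<open>D\<close> under the swap makes g normalise T.\<close>

lemma mat_g_mult_mat_h:
  "mat_g ** mat_h (a, b, c) = (mat_h (b, a, c) ** mat_g :: 'a::field ^ 4 ^ 4)"
  by (simp add: matrix_eq_iff_vector_4 algebra_simps flip: matrix_vector_mul_assoc)

lemma mat_g_mult_mat_g: "mat_g ** mat_g = (mat_h (1, 1, 0) :: 'a::field ^ 4 ^ 4)"
  by (simp add: matrix_eq_iff_vector_4 flip: matrix_vector_mul_assoc)

lemma mat_h_eq_iff [simp]: "mat_h d = (mat_h e :: 'a::field ^ 4 ^ 4) \<longleftrightarrow> d = e"
proof
  assume "mat_h d = mat_h e"
  \<comment> \<open>A translation is recovered from the image of the affine origin.\<close>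
  then have "mat_h d *v vector [0, 0, 0, 1] = mat_h e *v vector [0, 0, 0, 1]"
    by simp
  then show "d = e"
    by (cases d; cases e) simp
qed simp

text \<open>The linear parts differ: translations fix (1, 0, 0, 0), while g sends it to (0, 1, 0,
  0). So no element of Tg is a translation.\<close>

lemma mat_h_neq_mat_h_mult_mat_g: "mat_h d \<noteq> (mat_h e ** mat_g :: 'a::field ^ 4 ^ 4)"
proof
  assume "mat_h d = mat_h e ** mat_g"
  then have "mat_h d *v vector [1, 0, 0, 0] = mat_h e *v (mat_g *v vector [1, 0, 0, 0])"
    by (simp only: matrix_vector_mul_assoc)
  then show False
    by (cases d; cases e) simp
qed

lemma group_GL4: "group (GL4 :: ('a::field ^ 4 ^ 4) monoid)"
proof (rule groupI)
  fix A :: "'a ^ 4 ^ 4"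
  assume "A \<in> carrier GL4"
  then obtain B where "A ** B = mat 1" "B ** A = mat 1"
    by (auto simp: GL4_def invertible_def)
  then show "\<exists>B\<in>carrier GL4. B \<otimes>\<^bsub>GL4\<^esub> A = \<one>\<^bsub>GL4\<^esub>"
    by (auto simp: GL4_def invertible_def)
qed (auto simp: GL4_def invertible_mult matrix_mul_assoc, simp add: invertible_def)


section \<open>Matrix groups acting on subspaces\<close>

lemma inj_mult_vector_if_invertible:
  fixes A :: "'a::field ^ 'n ^ 'n"
  assumes "invertible A"
  shows "inj ((*v) A)"
  using assms by (metis invertible_def matrix_left_invertible_injective)

lemma dim_mult_vector_image:
  fixes A :: "'a::field ^ 'n ^ 'n"
  assumes "invertible A"
  shows "vec.dim ((*v) A ` W) = vec.dim W"
  by (intro vec.dim_image_eq matrix_vector_mul_linear_gen)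
    (use inj_mult_vector_if_invertible[OF assms] in \<open>auto intro: inj_on_subset\<close>)

lemma subspace_mult_vector_image:
  fixes A :: "'a::field ^ 'n ^ 'n"
  shows "vec.subspace W \<Longrightarrow> vec.subspace ((*v) A ` W)"
  by (intro vec.linear_subspace_image matrix_vector_mul_linear_gen)

lemma mult_vector_image_mult:
  fixes A B :: "'a::field ^ 'n ^ 'n"
  shows "(*v) (A ** B) ` W = (*v) A ` (*v) B ` W"
  by (simp add: image_image matrix_vector_mul_assoc)

lemma mult_vector_image_pg_point:
  "(*v) A ` pg_point x y z u = vec.span {A *v vector [x, y, z, u]}"
  unfolding pg_point_def
  by (subst vec.linear_span_image[OF matrix_vector_mul_linear_gen, symmetric]) simp

text \<open>The inverse of a matrix in \<open>K\<close> is again in \<open>K\<close> and so also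
  maps \<open>E\<close> into itself; hence each matrix of \<open>K\<close> induces a bijection of
  \<open>E\<close>.\<close>

lemma group_action_mat_action:
  assumes K: "subgroup K GL4" and "\<And>A W. A \<in> K \<Longrightarrow> W \<in> E \<Longrightarrow> (*v) A ` W \<in> E"
  shows "group_action (GL4\<lparr>carrier := K\<rparr>) E (mat_action E)"
proof -
  let ?G = "GL4\<lparr>carrier := K\<rparr>"
  have G: "group ?G"
    using K group_GL4 by (rule subgroup.subgroup_is_group)
  have inverse: "\<exists>B\<in>K. A ** B = mat 1 \<and> B ** A = mat 1" if "A \<in> K" for A
  proof -
    have "A \<in> carrier ?G"
      using that by simp
    then show ?thesis
      using group.l_inv[OF G] group.r_inv[OF G] group.inv_closed[OF G]
      by (fastforce simp: GL4_def)
  qed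
  have Bij: "mat_action E A \<in> Bij E" if A: "A \<in> K" for A
  proof -
    obtain B where B: "B \<in> K" "A ** B = mat 1" "B ** A = mat 1"
      using inverse[OF A] by blast
    have "bij_betw (mat_action E A) E E"
      using A B assms(2)
      by (intro bij_betw_byWitness[where f' = "mat_action E B"])
        (auto simp: mat_action_def simp flip: mult_vector_image_mult)
    then show ?thesis
      by (simp add: Bij_def mat_action_def)
  qed
  have "mat_action E (A ** B) = compose E (mat_action E A) (mat_action E B)"
    if "A \<in> K" "B \<in> K" for A B
    using that assms(2)
    by (auto simp: fun_eq_iff compose_def mat_action_def mult_vector_image_mult restrict_def)
  with Bij have "mat_action E \<in> hom ?G (BijGroup E)"
    by (auto simp: hom_def BijGroup_def GL4_def)
  then show ?thesis
    using G group_BijGroup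
    by (auto simp: group_action_def group_hom_def group_hom_axioms_def)
qed

text \<open>Incidence is inclusion, and an injective map preserves and reflects inclusion of
  subspaces.\<close>

lemma mat_action_is_automorphism:
  assumes "group_action (GL4\<lparr>carrier := K\<rparr>) (Points (T2star \<H>)) (mat_action (Points (T2star \<H>)))"
    and "group_action (GL4\<lparr>carrier := K\<rparr>) (Lines (T2star \<H>)) (mat_action (Lines (T2star \<H>)))"
    and "A \<in> K" "invertible A"
  shows "is_automorphism (T2star \<H>) (mat_action (Points (T2star \<H>)) A)
           (mat_action (Lines (T2star \<H>)) A)"
proof -
  have "Incident (T2star \<H>) P L \<longleftrightarrow> P \<subseteq> L" for P L
    by (simp add: T2star_def)
  then show ?thesis
    using group_action.bij_prop0[OF assms(1)] group_action.bij_prop0[OF assms(2)] assms(3)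
      inj_mult_vector_if_invertible[OF assms(4)]
    by (simp add: is_automorphism_def mat_action_def inj_image_subset_iff Bij_def)
qed

lemma mult_vector_image_in_Points:
  assumes "invertible A" "\<And>v. (A *v v) $ 4 = v $ 4" "P \<in> Points (T2star \<H>)"
  shows "(*v) A ` P \<in> Points (T2star \<H>)"
  using assms
  by (auto simp: T2star_def pg_points_def plane_at_infinity_def dim_mult_vector_image
      subspace_mult_vector_image)

text \<open>Since \<open>A\<close> preserves the plane at infinity, it carries the point at infinity
  of \<open>L\<close> to one of the image line. There is no other, because the inverse of
  \<open>A\<close> preserves the plane too and pulls every such point back to
  \<open>L\<close>.\<close>

lemma mult_vector_image_in_Lines:
  assumes A: "invertible A" "\<And>v. (A *v v) $ 4 = v $ 4" and "\<And>P. P \<in> \<H> \<Longrightarrow> (*v) A ` P \<in> \<H>"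
    and "L \<in> Lines (T2star \<H>)"
  shows "(*v) A ` L \<in> Lines (T2star \<H>)"
proof -
  obtain B where B: "A ** B = mat 1" "B ** A = mat 1"
    using A(1) by (auto simp: invertible_def)
  then have "invertible B"
    by (auto simp: invertible_def)
  have B4: "(B *v v) $ 4 = v $ 4" for v
    using A(2)[of "B *v v"] B by (simp add: matrix_vector_mul_assoc)
  let ?I = "\<lambda>L. {Q \<in> pg_points. Q \<subseteq> L \<and> Q \<subseteq> plane_at_infinity}"
  have image: "(*v) M ` Q \<in> ?I ((*v) M ` L)"
    if "invertible M" "\<And>v. (M *v v) $ 4 = v $ 4" "Q \<in> ?I L" for M Q and L :: "('a ^ 4) set"
    using that
    by (auto simp: pg_points_def plane_at_infinity_def dim_mult_vector_image
        subspace_mult_vector_image)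
  obtain P where P: "P \<in> \<H>" "?I L = {P}" and L: "L \<in> pg_lines"
    using assms(4) by (auto simp: T2star_def)
  have "Q = (*v) A ` P" if Q: "Q \<in> ?I ((*v) A ` L)" for Q
  proof -
    have "(*v) B ` Q \<in> ?I L"
      using image[OF \<open>invertible B\<close> B4 Q] B by (simp flip: mult_vector_image_mult)
    then have "P = (*v) B ` Q"
      using P(2) by blast
    then show ?thesis
      using B by (simp flip: mult_vector_image_mult)
  qed
  moreover have "(*v) A ` P \<in> ?I ((*v) A ` L)"
    using P(2) by (intro image A) blast
  ultimately have "?I ((*v) A ` L) = {(*v) A ` P}"
    by blast
  moreover have "(*v) A ` L \<in> pg_lines"
    using L A(1) by (simp add: pg_lines_def dim_mult_vector_image subspace_mult_vector_image)
  ultimately show ?thesis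
    using P(1) assms(3) by (auto simp: T2star_def)
qed


section \<open>Points of projective space\<close>

lemma pg_point_scale:
  assumes "c \<noteq> 0"
  shows "pg_point (c * x) (c * y) (c * z) (c * u) = pg_point x y z (u :: 'a::field)"
proof -
  let ?v = "vector [x, y, z, u] :: 'a ^ 4"
  have "c *s ?v \<in> vec.span {?v}"
    by (intro vec.span_scale vec.span_base) simp
  moreover have "?v \<in> vec.span {c *s ?v}"
    using vec.span_scale[OF vec.span_base, of "c *s ?v" "{c *s ?v}" "inverse c"] assms
    by (simp flip: mult.assoc)
  ultimately show ?thesis
    by (simp add: pg_point_def vec.span_eq)
qed

text \<open>The fourth coordinate 1 forces the scalar between the two spanning vectors to be
  1.\<close>

lemma pg_point_affine_inject:
  "pg_point x y z 1 = pg_point x' y' z' (1::'a::field) \<longleftrightarrow> x = x' \<and> y = y' \<and> z = z'"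
proof
  assume "pg_point x y z 1 = pg_point x' y' z' (1::'a)"
  then have "vector [x, y, z, 1] \<in> vec.span {vector [x', y', z', 1] :: 'a ^ 4}"
    by (metis pg_point_def insertI1 vec.span_base)
  then show "x = x' \<and> y = y' \<and> z = z'"
    by (auto simp: vec.span_singleton)
qed simp

text \<open>A point off the plane at infinity is spanned by a vector with nonzero fourth coordinate,
  which can be scaled to 1.\<close>

lemma Points_T2star: "Points (T2star \<H>) = {pg_point x y z (1::'a::field) | x y z. True}"
proof (intro equalityI subsetI)
  fix P :: "('a ^ 4) set"
  assume "P \<in> Points (T2star \<H>)"
  then have P: "vec.subspace P" "vec.dim P = 1" and "\<exists>v\<in>P. v $ 4 \<noteq> 0"
    by (auto simp: T2star_def pg_points_def plane_at_infinity_def)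
  then obtain x y z u where v: "vector [x, y, z, u] \<in> P" "u \<noteq> 0"
    by (metis vector_4(4) vector_4_cases)
  let ?v = "vector [x, y, z, u] :: 'a ^ 4"
  have "?v \<noteq> 0"
    using v(2) by (metis vector_4(4) zero_index)
  then have "vec.dim {?v} = 1"
    by (simp add: vec.dim_eq_card_independent)
  then have "pg_point x y z u = P"
    using P v(1) unfolding pg_point_def
    by (intro vec.subspace_dim_equal) (auto simp: vec.span_minimal)
  moreover have "pg_point x y z u = pg_point (x / u) (y / u) (z / u) 1"
    using pg_point_scale[of u "x / u" "y / u" "z / u" 1] v(2) by simp
  ultimately show "P \<in> {pg_point x y z 1 | x y z. True}"
    by blast
next
  fix P :: "('a ^ 4) set"
  assume "P \<in> {pg_point x y z 1 | x y z. True}"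
  then obtain x y z where P: "P = vec.span {vector [x, y, z, 1]}"
    by (auto simp: pg_point_def)
  let ?v = "vector [x, y, z, 1] :: 'a ^ 4"
  have "?v \<noteq> 0"
    by (metis vector_4(4) zero_index zero_neq_one)
  then have "vec.dim {?v} = 1"
    by (simp add: vec.dim_eq_card_independent)
  moreover have "?v \<in> P"
    by (simp add: P vec.span_base)
  ultimately show "P \<in> Points (T2star \<H>)"
    by (auto simp: T2star_def pg_points_def plane_at_infinity_def P intro!: bexI[of _ ?v])
qed


section \<open>Symmetry of the Payne hyperoval\<close>

text \<open>The exponents 1/6 and 5/6, as well as 3/6 and itself, add up to 1 modulo q - 1. Thus
  substituting 1/t and multiplying by t sends the term with exponent j/6 to the one with exponent (6
  - j)/6, which permutes the three terms.\<close>

lemma payne_fun_inverse: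
  fixes t :: "'a::{field,finite}"
  assumes card: "CARD('a) = 2 ^ h" and "h \<ge> 5" "odd h"
  shows "payne_fun 0 = (0::'a)" and "t \<noteq> 0 \<Longrightarrow> t * payne_fun (inverse t) = payne_fun t"
proof -
  define n where "n = int (2 ^ h) - 1"
  define r where "r = modular_inverse n 6"
  define e where "e k = sixths CARD('a) k" for k
  have "(32::int) \<le> 2 ^ h"
    using power_increasing[OF \<open>h \<ge> 5\<close>, of "2::int"] by simp
  then have n: "n \<ge> 31"
    by (simp add: n_def)
  \<comment> \<open>Writing \<open>h = 2 * k + 1\<close> gives 2^h = 2 * 4^k, which is 2 modulo 3,
    so \<open>n\<close> is 1 modulo 3; it is also odd.\<close>
  have "coprime 6 n"
  proof -
    obtain k where k: "h = 2 * k + 1"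
      using \<open>odd h\<close> by (elim oddE)
    have "[(4::int) ^ k = 1 ^ k] (mod 3)"
      by (intro cong_pow) (simp add: cong_def)
    then have "n mod 3 = 1"
      unfolding n_def k by (simp add: power_mult cong_def) presburger
    moreover have "odd n"
      using \<open>h \<ge> 5\<close> by (simp add: n_def)
    ultimately have "\<not> 3 dvd n" "coprime 2 n"
      by auto
    moreover have "prime (3::int)"
      by simp
    ultimately have "coprime (2 * 3) n"
      unfolding coprime_mult_left_iff by (auto intro: prime_imp_coprime)
    then show ?thesis
      by simp
  qed
  then have r: "[6 * r = 1] (mod n)"
    unfolding r_def by (rule cong_modular_inverse1)
  have e: "[int (e k) = int k * r] (mod n)" for k
    using n by (simp add: e_def sixths_def card cong_def r_def n_def)
  \<comment> \<open>A zero exponent would make k/6, and hence \<open>k\<close> itself, vanish modulo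
    \<open>n\<close>, which exceeds 6. Positivity matters because \<open>0 ^ 0 = 1\<close>.\<close>
  have e_pos: "e k > 0" if "0 < k" "k < 6" for k
  proof (rule ccontr)
    assume "\<not> e k > 0"
    then have "[int k * r = 0] (mod n)"
      using e[of k] by (simp add: cong_sym)
    then have "[6 * (int k * r) = 6 * 0] (mod n)"
      by (rule cong_scalar_left)
    moreover have "[6 * (int k * r) = int k * 1] (mod n)"
      using cong_scalar_left[OF r, of "int k"] by (simp add: ac_simps)
    ultimately have "[int k = 0] (mod n)"
      by (metis cong_sym cong_trans mult_1_right mult_zero_right)
    then show False
      using that n by (simp add: cong_def)
  qed
  from this[of 1] this[of 3] this[of 5] show "payne_fun 0 = (0::'a)"
    by (simp add: payne_fun_def zero_power flip: e_def)
  assume t: "t \<noteq> 0"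
  have power_e: "t ^ e j * t ^ e k = t" if "j + k = 6" "j > 0" "k > 0" for j k
  proof -
    have "[int (e j + e k) = int j * r + int k * r] (mod n)"
      using cong_add[OF e e] by simp
    also have "int j * r + int k * r = 6 * r"
      using that by (metis distrib_right of_nat_add of_nat_numeral)
    also note r
    finally have "[int (e j + e k) = int 1] (mod int (2 ^ h - 1))"
      by (simp add: n_def of_nat_diff)
    then have "[e j + e k = 1] (mod 2 ^ h - 1)"
      by (simp only: cong_int_iff)
    \<comment> \<open>With this bound the congruence to 1 becomes an equation over the naturals: the
      sum is 1 plus a nonnegative multiple of q - 1.\<close>
    moreover have "e j + e k \<ge> 1"
      using e_pos[of j] that by simp
    ultimately obtain m where "e j + e k = 1 + (2 ^ h - 1) * m"
      by (metis cong_to_1'_nat One_nat_def add.commute mult.commute not_one_le_zero)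
    then have "t ^ e j * t ^ e k = t * (t ^ (CARD('a) - 1)) ^ m"
      by (simp add: card power_mult flip: power_add)
    then show ?thesis
      using finite_field_power_card_minus_1[OF t] by simp
  qed
  have "t * inverse t ^ e j = t ^ e k" if "j + k = 6" "j > 0" "k > 0" for j k
    using power_e[OF that] t by (simp add: field_simps)
  from this[of 1 5] this[of 3 3] this[of 5 1]
  show "t * payne_fun (inverse t) = payne_fun t"
    by (simp add: payne_fun_def distrib_left flip: e_def)
qed

text \<open>Translations act trivially on vectors with fourth coordinate 0.\<close>

lemma mat_h_payne_hyperoval:
  assumes "P \<in> payne_hyperoval"
  shows "(*v) (mat_h d) ` P = P"
proof -
  obtain x y z where "P = pg_point x y z 0"
    using assms by (auto simp: payne_hyperoval_def)
  then show ?thesis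
    by (cases d) (simp add: mult_vector_image_pg_point, simp add: pg_point_def)
qed

text \<open>On the plane at infinity g swaps X and Y. It fixes (0, 0, 1), exchanges (0, 1, 0) with
  the point of parameter 0, and sends any other parameter \<open>t\<close> to its inverse.\<close>

lemma mat_g_payne_hyperoval:
  assumes "CARD('a::{field,finite}) = 2 ^ h" "h \<ge> 5" "odd h"
    and "(P :: ('a ^ 4) set) \<in> payne_hyperoval"
  shows "(*v) mat_g ` P \<in> payne_hyperoval"
proof -
  note payne = payne_fun_inverse[OF assms(1-3)]
  have g: "(*v) mat_g ` pg_point x y z 0 = pg_point y x z (0::'a)" for x y z
    by (simp add: mult_vector_image_pg_point) (simp add: pg_point_def)
  from assms(4) consider t where "P = pg_point 1 t (payne_fun t) 0"
    | "P = pg_point 0 0 1 0" | "P = pg_point 0 1 0 0"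
    by (auto simp: payne_hyperoval_def)
  then show ?thesis
  proof cases
    case 1
    show ?thesis
    proof (cases "t = 0")
      case True
      then show ?thesis
        by (simp add: 1 g payne(1)) (simp add: payne_hyperoval_def)
    next
      case False
      have "(*v) mat_g ` P = pg_point t 1 (payne_fun t) 0"
        by (simp add: 1 g)
      \<comment> \<open>The coordinates are divided by \<open>t\<close>, using f(t) = t
        f(1/t).\<close>
      also have "\<dots> = pg_point 1 (inverse t) (payne_fun (inverse t)) 0"
        using pg_point_scale[of t 1 "inverse t" "payne_fun (inverse t)" 0] payne(2)[of t] False
        by simp
      finally show ?thesis
        by (auto simp: payne_hyperoval_def)
    qed
  next
    case 3
    have "pg_point 1 0 0 0 = pg_point 1 0 (payne_fun 0) (0::'a)"
      by (simp add: payne(1))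
    then show ?thesis
      unfolding 3 g by (auto simp: payne_hyperoval_def)
  qed (auto simp: g payne_hyperoval_def)
qed


section \<open>The group generated by g and T\<close>

context
  fixes h :: nat and D :: "('a::{field,finite} \<times> 'a \<times> 'a) set"
  assumes card: "CARD('a) = 2 ^ h" and "h > 0" and adm: "admissible h D"
begin

section \<open>Additive structure of the subgroup \<open>D\<close>\<close>

lemma add_self: "x + x = (0::'a)"
  using two_eq_0_if_card[OF card] by (rule char_2_add_self)

lemma add_self_triple: "d + d = (0 :: 'a \<times> 'a \<times> 'a)"
  by (cases d) (simp add: add_self zero_prod_def)

lemma D_zero: "0 \<in> D"
  using adm subgroup.one_closed by (fastforce simp: admissible_def additive_group_def)

lemma D_add: "d \<in> D \<Longrightarrow> e \<in> D \<Longrightarrow> d + e \<in> D"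
  using adm subgroup.m_closed by (fastforce simp: admissible_def additive_group_def)

lemma D_swap: "(a, b, c) \<in> D \<Longrightarrow> (b, a, c) \<in> D"
  using adm by (simp add: admissible_def)

text \<open>By its cardinality \<open>D\<close> is half of the whole group, so its complement is the
  single coset \<open>d + D\<close>; then \<open>e = d + a\<close> with \<open>a\<close> in
  \<open>D\<close>, and adding \<open>d\<close> leaves \<open>a\<close>.\<close>

lemma D_index_2:
  assumes "d \<notin> D" "e \<notin> D"
  shows "d + e \<in> D"
proof -
  note self = add_self_triple
  have disj: "D \<inter> (+) d ` D = {}"
  proof (rule ccontr)
    assume "D \<inter> (+) d ` D \<noteq> {}"
    then obtain a where a: "a \<in> D" "d + a \<in> D"
      by blast
    have "d = d + a + a"
      using self[of a] by (simp add: add.assoc)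
    then show False
      using D_add[OF a(2,1)] assms(1) by metis
  qed
  have "card (D \<union> (+) d ` D) = 2 * card D"
    using disj by (simp add: card_Un_disjoint card_image)
  also have "\<dots> = 2 ^ (3 * h)"
    using adm \<open>h > 0\<close> by (simp add: admissible_def flip: power_Suc)
  also have "\<dots> = CARD('a \<times> 'a \<times> 'a)"
    using card by (simp add: power_add[symmetric])
  finally have "D \<union> (+) d ` D = UNIV"
    by (intro card_subset_eq) auto
  then obtain a where "a \<in> D" "e = d + a"
    using assms(2) by blast
  then show ?thesis
    using self[of d] by (simp flip: add.assoc)
qed

text \<open>
  Since \<open>D\<close> has index 2 and is invariant under the swap, it contains the whole diagonal \<open>(s, s, 0)\<close>.
\<close>

lemma not_in_D: "(s + 1, s, 0) \<notin> D"
proof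
  assume *: "(s + 1, s, 0) \<in> D"
  \<comment> \<open>The two summands are swaps of each other, so both lie in \<open>D\<close> or
    neither does; the sum is in \<open>D\<close> either way.\<close>
  have "(s, 0, 0) + (0, s, 0) \<in> D"
    by (cases "(s, 0, 0) \<in> D") (auto intro: D_swap D_add D_index_2 simp del: add_Pair)
  from D_add[OF * this] have "(1, 0, 0) \<in> D"
    using add_self[of s] by (simp add: ac_simps)
  then show False
    using adm by (simp add: admissible_def)
qed


section \<open>The union of T and Tg as a matrix group\<close>

text \<open>An explicit normal form for the elements of S; \<open>group_S_eq\<close> identifies it
  with the generated group.\<close>

definition S_set :: "('a ^ 4 ^ 4) set" where
  "S_set = mat_h ` D \<union> (\<lambda>d. mat_h d ** mat_g) ` D"

lemma S_setE:
  assumes "A \<in> S_set"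
  obtains d where "d \<in> D" "A = mat_h d" | d where "d \<in> D" "A = mat_h d ** mat_g"
  using assms by (auto simp: S_set_def)

lemma mat_h_in_S_set: "d \<in> D \<Longrightarrow> mat_h d \<in> S_set"
  by (simp add: S_set_def)

lemma mat_h_mult_mat_g_in_S_set: "d \<in> D \<Longrightarrow> mat_h d ** mat_g \<in> S_set"
  by (simp add: S_set_def)

lemma D_diag: "(1, 1, 0) \<in> D"
  using adm by (simp add: admissible_def)

lemma mat_h_mult_cancel: "mat_h d ** mat_h d = (mat 1 :: 'a ^ 4 ^ 4)"
  by (simp add: mat_h_mult add_self_triple mat_h_0)

text \<open>Moves g to the right past an element of T, at the cost of replacing it by another
  element of T.\<close>

lemma mat_g_mult_mat_h_in:
  assumes "d \<in> D"
  obtains e where "e \<in> D" "mat_g ** mat_h d = mat_h e ** mat_g"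
proof -
  obtain a b c where "d = (a, b, c)"
    by (metis surj_pair)
  then show ?thesis
    using that[of "(b, a, c)"] D_swap assms by (simp add: mat_g_mult_mat_h)
qed

text \<open>Every factor g can be collected on the right; two of them combine to the translation by
  (1, 1, 0), which belongs to T.\<close>

lemma mult_in_S_set:
  assumes "A \<in> S_set" "B \<in> S_set"
  shows "A ** B \<in> S_set"
  using assms(2)
proof (cases rule: S_setE)
  case e: (1 e)
  obtain e' where e': "e' \<in> D" "mat_g ** mat_h e = mat_h e' ** mat_g"
    using mat_g_mult_mat_h_in[OF e(1)] by blast
  from assms(1) show ?thesis
  proof (cases rule: S_setE)
    case (1 d)
    then show ?thesis
      using e by (auto simp: mat_h_mult intro: mat_h_in_S_set D_add)
  next
    case (2 d)
    have "A ** B = mat_h d ** (mat_g ** mat_h e)"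
      by (simp add: 2 e matrix_mul_assoc)
    also have "\<dots> = mat_h (d + e') ** mat_g"
      by (simp add: e' matrix_mul_assoc mat_h_mult)
    finally show ?thesis
      using 2 e' by (auto intro: mat_h_mult_mat_g_in_S_set D_add)
  qed
next
  case e: (2 e)
  obtain e' where e': "e' \<in> D" "mat_g ** mat_h e = mat_h e' ** mat_g"
    using mat_g_mult_mat_h_in[OF e(1)] by blast
  from assms(1) show ?thesis
  proof (cases rule: S_setE)
    case (1 d)
    then have "A ** B = mat_h (d + e) ** mat_g"
      by (simp add: e matrix_mul_assoc mat_h_mult)
    then show ?thesis
      using 1 e by (auto intro: mat_h_mult_mat_g_in_S_set D_add)
  next
    case (2 d)
    have "A ** B = mat_h d ** (mat_g ** mat_h e) ** mat_g"
      by (simp add: 2 e matrix_mul_assoc)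
    also have "\<dots> = mat_h d ** mat_h e' ** (mat_g ** mat_g)"
      by (simp add: e' matrix_mul_assoc)
    also have "\<dots> = mat_h (d + e' + (1, 1, 0))"
      by (simp add: mat_g_mult_mat_g mat_h_mult)
    finally show ?thesis
      using 2 e' by (auto intro!: mat_h_in_S_set D_add D_diag simp del: add_Pair)
  qed
qed

lemma square_in_translations:
  assumes "A \<in> S_set"
  obtains e where "A ** A = mat_h e"
  using assms
proof (cases rule: S_setE)
  case (1 d)
  then show ?thesis
    using that mat_h_mult by metis
next
  case (2 d)
  obtain e where e: "mat_g ** mat_h d = mat_h e ** mat_g"
    using mat_g_mult_mat_h_in[OF 2(1)] by blast
  have "A ** A = mat_h d ** (mat_g ** mat_h d) ** mat_g"
    by (simp add: 2 matrix_mul_assoc)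
  also have "\<dots> = mat_h d ** mat_h e ** (mat_g ** mat_g)"
    by (simp add: e matrix_mul_assoc)
  also have "\<dots> = mat_h (d + e + (1, 1, 0))"
    by (simp add: mat_g_mult_mat_g mat_h_mult)
  finally show ?thesis
    by (rule that)
qed

text \<open>The square is a translation, and in characteristic 2 every translation squares to the
  identity.\<close>

lemma fourth_power:
  assumes "A \<in> S_set"
  shows "A ** A ** (A ** A) = mat 1"
  using square_in_translations[OF assms] mat_h_mult_cancel by metis

text \<open>The inverse is the cube, so closure under products is enough.\<close>

lemma S_set_inverse:
  assumes "A \<in> S_set"
  obtains B where "B \<in> S_set" "A ** B = mat 1" "B ** A = mat 1"
proof -
  have "A ** A ** A \<in> S_set"
    using assms by (intro mult_in_S_set)
  then show ?thesis
    using that[of "A ** A ** A"] fourth_power[OF assms] by (simp add: matrix_mul_assoc)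
qed

lemma invertible_S_set: "A \<in> S_set \<Longrightarrow> invertible A"
  by (metis S_set_inverse invertible_def)

lemma subgroup_S_set: "subgroup S_set GL4"
proof (rule group.subgroupI[OF group_GL4])
  show "S_set \<subseteq> carrier GL4"
    using invertible_S_set by (auto simp: GL4_def)
  show "S_set \<noteq> {}"
    using D_zero by (auto simp: S_set_def)
  fix A
  assume A: "A \<in> S_set"
  then obtain B where B: "B \<in> S_set" "A ** B = mat 1" "B ** A = mat 1"
    by (rule S_set_inverse)
  then have "inv\<^bsub>GL4\<^esub> A = B"
    using A invertible_S_set
    by (intro group.inv_equality[OF group_GL4]) (auto simp: GL4_def)
  then show "inv\<^bsub>GL4\<^esub> A \<in> S_set"
    using B(1) by simp
  fix B
  assume "B \<in> S_set"
  then show "A \<otimes>\<^bsub>GL4\<^esub> B \<in> S_set"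
    using mult_in_S_set[OF A] by (simp add: GL4_def)
qed

lemma mat_g_in_S_set: "mat_g \<in> S_set"
  using mat_h_mult_mat_g_in_S_set[OF D_zero] by (simp add: mat_h_0)

text \<open>The union is a subgroup containing the generators, and each of its elements is a
  generator or a product of two.\<close>

lemma group_S_eq: "group_S D = GL4\<lparr>carrier := S_set\<rparr>"
proof -
  let ?X = "{mat_g} \<union> mat_h ` D"
  have "generate GL4 ?X \<subseteq> S_set"
    using mat_g_in_S_set
    by (intro group.generate_subgroup_incl[OF group_GL4] subgroup_S_set) (auto simp: S_set_def)
  moreover have "mat_h d ** mat_g \<in> generate GL4 ?X" if "d \<in> D" for d
    using generate.eng[of "mat_h d" GL4 ?X mat_g] that
    by (auto simp: GL4_def intro: generate.incl)
  then have "S_set \<subseteq> generate GL4 ?X"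
    by (auto simp: S_set_def intro: generate.incl)
  ultimately show ?thesis
    by (simp add: group_S_def)
qed

lemma carrier_Int_translations: "carrier (group_S D) \<inter> range mat_h = mat_h ` D"
  using mat_h_neq_mat_h_mult_mat_g by (fastforce simp: group_S_eq S_set_def
      simp del: split_paired_All)

section \<open>Action on the hyperoval and on the affine points\<close>

lemma S_set_fixes_height:
  assumes "A \<in> S_set"
  shows "(A *v v) $ 4 = v $ 4"
proof -
  obtain x y z u where v: "v = vector [x, y, z, u]"
    by (rule vector_4_cases)
  have "(mat_h d *v vector [x, y, z, u]) $ 4 = u" for d and x y z u :: 'a
    by (cases d) simp
  with assms show ?thesis
    by (cases rule: S_setE) (simp_all add: v flip: matrix_vector_mul_assoc)
qed

lemma S_set_payne_hyperoval:
  assumes "h \<ge> 5" "odd h" "A \<in> S_set" "P \<in> payne_hyperoval"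
  shows "(*v) A ` P \<in> payne_hyperoval"
  using assms(3)
proof (cases rule: S_setE)
  case 1
  then show ?thesis
    using mat_h_payne_hyperoval assms(4) by metis
next
  case 2
  then show ?thesis
    using mat_h_payne_hyperoval mat_g_payne_hyperoval[OF card assms(1,2,4)]
    by (metis mult_vector_image_mult)
qed

lemma mat_h_affine_point:
  "(*v) (mat_h (a, b, c)) ` pg_point x y z 1 = pg_point (x + a) (y + b) (z + (c::'a)) 1"
  by (simp add: mult_vector_image_pg_point) (simp add: pg_point_def)

lemma mat_h_mult_mat_g_affine_point:
  "(*v) (mat_h (a, b, c) ** mat_g) ` pg_point x y z 1 =
     pg_point (y + 1 + a) (x + b) (z + (c::'a)) 1"
  by (simp only: mult_vector_image_mult)
    (simp add: mult_vector_image_pg_point mat_h_affine_point flip: pg_point_def)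

text \<open>Only one translation, by \<open>d\<close>, and only one element of the form
  \<open>mat_h e ** mat_g\<close> map the first point to the second. The sum \<open>d + e\<close>
  has the form (s + 1, s, 0), so exactly one of \<open>d\<close> and \<open>e\<close> lies in
  \<open>D\<close>.\<close>

lemma sharply_transitive:
  "\<exists>!A. A \<in> S_set \<and> (*v) A ` pg_point x y z 1 = pg_point x' y' z' (1::'a)"
proof -
  define d where "d = (x' - x, y' - y, z' - z)"
  define e where "e = (x' - y - 1, y' - x, z' - z)"
  have h: "(*v) (mat_h f) ` pg_point x y z 1 = pg_point x' y' z' 1 \<longleftrightarrow> f = d" for f
    by (cases f) (auto simp: mat_h_affine_point pg_point_affine_inject d_def)
  have hg: "(*v) (mat_h f ** mat_g) ` pg_point x y z 1 = pg_point x' y' z' 1 \<longleftrightarrow> f = e" for f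
    by (cases f) (auto simp: mat_h_mult_mat_g_affine_point pg_point_affine_inject e_def)
  have minus: "- t = t" for t :: 'a
    using add_self by (simp add: minus_unique)
  \<comment> \<open>The terms are grouped so that everything outside (s + 1, s, 0) with
    \<open>s = y - x\<close> is doubled and vanishes in characteristic 2.\<close>
  have "d + e = (x' + x' + (y - x + 1) + (- 1 - 1 - y - y),
      y' + y' + (y - x) + (- y - y), z' + z' + (- z - z))"
    by (simp add: d_def e_def)
  also have "\<dots> = (y - x + 1, y - x, 0)"
    using add_self[of y] add_self[of "1::'a"]
    by (simp only: add_self diff_conv_add_uminus minus add_0 add_0_right add.assoc)
  finally have "d + e \<notin> D"
    using not_in_D by simp
  \<comment> \<open>If both were in \<open>D\<close>, or both outside it, index 2 would put their
    sum in \<open>D\<close>.\<close>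
  then have "d \<in> D \<longleftrightarrow> e \<notin> D"
    using D_add D_index_2 by blast
  then consider "d \<in> D" "e \<notin> D" | "d \<notin> D" "e \<in> D"
    by blast
  then show ?thesis
  proof cases
    case 1
    then show ?thesis
      by (intro ex1I[of _ "mat_h d"]) (auto simp: S_set_def h hg)
  next
    case 2
    then show ?thesis
      by (intro ex1I[of _ "mat_h e ** mat_g"]) (auto simp: S_set_def h hg)
  qed
qed

lemma S_acts_as_Singer_group:
  assumes "h \<ge> 5" "odd h"
  shows "acts_as_Singer_group (group_S D) (T2star payne_hyperoval)
           (mat_action (Points (T2star payne_hyperoval)))
           (mat_action (Lines (T2star payne_hyperoval)))"
proof -
  let ?\<Gamma> = "T2star (payne_hyperoval :: ('a ^ 4) set set)"
  have points: "group_action (group_S D) (Points ?\<Gamma>) (mat_action (Points ?\<Gamma>))"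
    unfolding group_S_eq
    by (intro group_action_mat_action subgroup_S_set mult_vector_image_in_Points
        invertible_S_set S_set_fixes_height)
  have lines: "group_action (group_S D) (Lines ?\<Gamma>) (mat_action (Lines ?\<Gamma>))"
    unfolding group_S_eq
    by (intro group_action_mat_action subgroup_S_set mult_vector_image_in_Lines
        invertible_S_set S_set_fixes_height S_set_payne_hyperoval assms)
  have "\<exists>!A. A \<in> carrier (group_S D) \<and> mat_action (Points ?\<Gamma>) A P = P'"
    if PP': "P \<in> Points ?\<Gamma>" "P' \<in> Points ?\<Gamma>" for P P'
  proof -
    obtain x y z x' y' z' where "P = pg_point x y z 1" "P' = pg_point x' y' z' 1"
      using PP' by (auto simp: Points_T2star)
    then have "\<exists>!A. A \<in> S_set \<and> (*v) A ` P = P'"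
      using sharply_transitive by simp
    moreover have "mat_action (Points ?\<Gamma>) A P = (*v) A ` P" for A
      using PP'(1) by (simp add: mat_action_def)
    ultimately show ?thesis
      by (simp add: group_S_eq)
  qed
  with points lines show ?thesis
    using mat_action_is_automorphism[OF points[unfolded group_S_eq] lines[unfolded group_S_eq]]
      invertible_S_set
    by (auto simp: acts_as_Singer_group_def group_S_eq)
qed

section \<open>Exponent of S and order of its translation subgroup\<close>

text \<open>The element g has order exactly 4: its square is the nontrivial translation by (1, 1,
  0), while g and its cube lie in Tg and so differ from the identity.\<close>

lemma S_has_exponent_4: "has_exponent (group_S D) 4"
proof -
  have pow: "A [^]\<^bsub>group_S D\<^esub> (1::nat) = A" "A [^]\<^bsub>group_S D\<^esub> (2::nat) = A ** A"
    "A [^]\<^bsub>group_S D\<^esub> (3::nat) = A ** A ** A"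
    "A [^]\<^bsub>group_S D\<^esub> (4::nat) = A ** A ** (A ** A)" for A
    by (simp_all add: nat_pow_def numeral_eq_Suc group_S_def GL4_def matrix_mul_assoc)
  have one: "\<one>\<^bsub>group_S D\<^esub> = mat 1"
    by (simp add: group_S_def GL4_def)
  have g: "mat_g \<noteq> (mat 1 :: 'a ^ 4 ^ 4)"
    using mat_h_neq_mat_h_mult_mat_g[of 0 "0 :: 'a \<times> 'a \<times> 'a"] by (simp add: mat_h_0)
  have gg: "mat_g ** mat_g \<noteq> (mat 1 :: 'a ^ 4 ^ 4)"
    unfolding mat_g_mult_mat_g by (simp add: zero_prod_def flip: mat_h_0)
  have ggg: "mat_g ** mat_g ** mat_g \<noteq> (mat 1 :: 'a ^ 4 ^ 4)"
    unfolding mat_g_mult_mat_g by (metis mat_h_0 mat_h_neq_mat_h_mult_mat_g)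
  have "\<not> (\<forall>A\<in>S_set. A [^]\<^bsub>group_S D\<^esub> m = mat 1)" if "0 < m" "m < 4" for m :: nat
  proof -
    have "m = 1 \<or> m = 2 \<or> m = 3"
      using that by auto
    then show ?thesis
      using g gg ggg
      by (intro notI)
        (drule bspec[OF _ mat_g_in_S_set], auto simp: pow simp del: One_nat_def)
  qed
  moreover have "carrier (group_S D) = S_set"
    by (simp add: group_S_eq)
  ultimately show ?thesis
    using fourth_power by (simp add: has_exponent_def one pow(4))
qed

text \<open>The translations in S are exactly those by vectors of \<open>D\<close>, and distinct
  vectors give distinct matrices, so the count is the cardinality of \<open>D\<close>.\<close>

lemma card_carrier_Int_translations:
  "real (card (carrier (group_S D) \<inter> range mat_h)) = real (2 ^ h) ^ 3 / 2"
proof -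
  have "card (carrier (group_S D) \<inter> range mat_h) = 2 ^ (3 * h - 1)"
    using adm by (simp add: carrier_Int_translations card_image inj_on_def admissible_def)
  moreover have "2 * 2 ^ (3 * h - 1) = (2 ^ h :: real) ^ 3"
    using \<open>h > 0\<close> by (simp add: mult.commute flip: power_Suc power_mult)
  ultimately show ?thesis
    by simp
qed

end


theorem mainTheorem9:
  fixes h q :: nat
  assumes "CARD('a::{field,finite}) = q" and "q = 2 ^ h" and "h \<ge> 5" and "odd h"
  shows "(\<exists>D :: ('a \<times> 'a \<times> 'a) set. admissible h D) \<and>
    (\<forall>D :: ('a \<times> 'a \<times> 'a) set. admissible h D \<longrightarrow>
       acts_as_Singer_group (group_S D) (T2star payne_hyperoval)
         (mat_action (Points (T2star payne_hyperoval)))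
         (mat_action (Lines (T2star payne_hyperoval))) \<and>
       has_exponent (group_S D) 4 \<and>
       real (card (carrier (group_S D) \<inter> range mat_h)) = real q ^ 3 / 2)"
proof (intro conjI allI impI)
  have card: "CARD('a) = 2 ^ h" and "h > 0"
    using assms by auto
  then show "\<exists>D :: ('a \<times> 'a \<times> 'a) set. admissible h D"
    by (rule admissible_exists)
  fix D :: "('a \<times> 'a \<times> 'a) set"
  assume D: "admissible h D"
  note ctx = card \<open>h > 0\<close> D
  show "acts_as_Singer_group (group_S D) (T2star payne_hyperoval)
      (mat_action (Points (T2star payne_hyperoval))) (mat_action (Lines (T2star payne_hyperoval)))"
    using ctx assms(3,4) by (rule S_acts_as_Singer_group)
  show "has_exponent (group_S D) 4"
    using ctx by (rule S_has_exponent_4)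
  show "real (card (carrier (group_S D) \<inter> range mat_h)) = real q ^ 3 / 2"
    using card_carrier_Int_translations[OF ctx] assms(2) by simp
qed

end
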